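(* Let $n \ge 0$ be an integer. For every choice of signs $\varepsilon_R \in \{-1,1\}$, indexed by the dyadic rectangles $R \subseteq [0,1)^2$ with $|R| = 2^{-n}$, for every integer $k$ with $0 \le k \le n+1$, and for every dyadic rectangle $Q \subseteq [0,1)^2$ with $|Q| \ge 2^{-n-1}$, $$\left| \left\{ x \in Q : \sum_{|R| = 2^{-n}} \varepsilon_R h_R(x) = n+1-2k \right\} \right| = \frac{|Q|}{2^{n+1}} \binom{n+1}{k},$$ where the sum runs over all dyadic rectangles $R \subseteq [0,1)^2$ with $|R| = 2^{-n}$.
   Context: A dyadic interval is an interval of the form $[m2^{-j}, (m+1)2^{-j})$ contained in $[0,1)$, where $m, j \ge 0$ are integers. For a dyadic interval $I$, the associated Haar function $h_I$ is $h_I = -\mathbf{1}_{\text{left}} + \mathbf{1}_{\text{right}}$, i.e. it equals $-1$ on the left half $[m2^{-j}, (m+\tfrac12)2^{-j})$ of $I$, $+1$ on the right half $[(m+\tfrac12)2^{-j}, (m+1)2^{-j})$ of $I$, and $0$ outside $I$. A dyadic rectangle in $[0,1)^2$ is a product $R = R_1 \times R_2$ of two dyadic intervals (of possibly different lengths), and its associated Haar function is $h_R(x_1,x_2) = h_{R_1}(x_1)\, h_{R_2}(x_2)$. For a measurable set $A \subseteq [0,1)^2$, $|A|$ denotes its area (two-dimensional Lebesgue measure). *)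

theory Defs
  imports "HOL-Analysis.Analysis"
begin

definition dyadic_intervals :: "real set set" where
  "dyadic_intervals =
     {I. I \<subseteq> {0..<1} \<and> (\<exists>m j::nat. I = {real m / 2 ^ j ..< (real m + 1) / 2 ^ j})}"

definition dyadic_rectangles :: "(real \<times> real) set set" where
  "dyadic_rectangles = {I \<times> J | I J. I \<in> dyadic_intervals \<and> J \<in> dyadic_intervals}"

text \<open>
  The Haar functions take the interval or rectangle itself as their argument. The end points
  of a nonempty half-open interval \<open>I\<close> are \<open>Inf I\<close> and \<open>Sup I\<close>, and the sides of a nonempty
  rectangle are its two projections; \<open>haar_dyadic_interval\<close> and \<open>haar_rect_Times\<close> below recover
  the usual descriptions.
\<close>

definition haar :: "real set \<Rightarrow> real \<Rightarrow> real" where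
  "haar I x = - indicator {Inf I ..< (Inf I + Sup I) / 2} x
              + indicator {(Inf I + Sup I) / 2 ..< Sup I} x"

definition haar_rect :: "(real \<times> real) set \<Rightarrow> real \<times> real \<Rightarrow> real" where
  "haar_rect R x = haar (fst ` R) (fst x) * haar (snd ` R) (snd x)"

abbreviation area :: "(real \<times> real) set \<Rightarrow> real" where
  "area A \<equiv> measure lebesgue A"

lemma haar_dyadic_interval:
  "haar {real m / 2 ^ j ..< (real m + 1) / 2 ^ j} x =
     - indicator {real m / 2 ^ j ..< (real m + 1 / 2) / 2 ^ j} x
     + indicator {(real m + 1 / 2) / 2 ^ j ..< (real m + 1) / 2 ^ j} x"
proof -
  have "real m / 2 ^ j < (real m + 1) / 2 ^ j"
    by (simp add: divide_strict_right_mono)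
  moreover have "(real m / 2 ^ j + (real m + 1) / 2 ^ j) / 2 = (real m + 1 / 2) / 2 ^ j"
    by (simp add: field_simps)
  ultimately show ?thesis
    by (simp only: haar_def cInf_atLeastLessThan cSup_atLeastLessThan)
qed

lemma dyadic_interval_nonempty: "I \<in> dyadic_intervals \<Longrightarrow> I \<noteq> {}"
  by (auto simp: dyadic_intervals_def divide_strict_right_mono not_le)

lemma haar_rect_Times:
  assumes "I \<in> dyadic_intervals" "J \<in> dyadic_intervals"
  shows "haar_rect (I \<times> J) (x, y) = haar I x * haar J y"
  using assms dyadic_interval_nonempty by (simp add: haar_rect_def)

lemma area_dyadic_rectangle:
  "area ({real m / 2 ^ i ..< (real m + 1) / 2 ^ i} \<times> {real l / 2 ^ j ..< (real l + 1) / 2 ^ j})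
     = 1 / 2 ^ (i + j)"
proof -
  have *: "real m / 2 ^ i \<le> (real m + 1) / 2 ^ i" for m i :: nat
    by (simp add: divide_right_mono)
  have d: "(real m + 1) / 2 ^ i - real m / 2 ^ i = 1 / 2 ^ i" for m i :: nat
    by (simp add: diff_divide_distrib [symmetric])
  have e: "emeasure lborel {real m / 2 ^ i ..< (real m + 1) / 2 ^ i} = ennreal (1 / 2 ^ i)"
    for m i :: nat
    using emeasure_lborel_Ico [OF *] by (simp only: d)
  have "emeasure lborel ({real m / 2 ^ i ..< (real m + 1) / 2 ^ i}
          \<times> {real l / 2 ^ j ..< (real l + 1) / 2 ^ j}) = ennreal (1 / 2 ^ i) * ennreal (1 / 2 ^ j)"
    unfolding lborel_prod [symmetric] by (subst lborel.emeasure_pair_measure_Times) (simp_all only: e, simp_all)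
  also have "\<dots> = ennreal (1 / 2 ^ (i + j))"
    by (simp add: ennreal_mult [symmetric] power_add)
  finally have "measure lborel ({real m / 2 ^ i ..< (real m + 1) / 2 ^ i}
          \<times> {real l / 2 ^ j ..< (real l + 1) / 2 ^ j}) = 1 / 2 ^ (i + j)"
    by (simp add: measure_def)
  then show ?thesis
    by (simp add: borel_Times)
qed

text \<open>A sum over an infinite index set would be \<open>0\<close> by convention; this does not occur here.\<close>

lemma finite_dyadic_rectangles_of_area: "finite {R \<in> dyadic_rectangles. area R = 1 / 2 ^ n}" (is "finite ?A")
proof -
  let ?D = "\<lambda>m j::nat. {real m / 2 ^ j ..< (real m + 1) / 2 ^ j}"
  have bound: "m < 2 ^ j" if "?D m j \<subseteq> {0..<1}" for m j :: nat
  proof -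
    have "real m / 2 ^ j \<in> ?D m j"
      by (simp add: divide_strict_right_mono)
    with that have "real m / 2 ^ j < 1"
      by (meson subsetD atLeastLessThan_iff)
    then have "real m < real (2 ^ j)"
      by (simp add: field_simps)
    then show ?thesis
      by (simp only: of_nat_less_iff)
  qed
  let ?S = "{..n} \<times> {..n} \<times> {..<(2::nat) ^ n} \<times> {..<(2::nat) ^ n}"
  have "?A \<subseteq> (\<lambda>(i, j, m, l). ?D m i \<times> ?D l j) ` ?S"
  proof
    fix R assume "R \<in> ?A"
    then obtain m i l j where R: "R = ?D m i \<times> ?D l j" "area R = 1 / 2 ^ n"
      and sub: "?D m i \<subseteq> {0..<1}" "?D l j \<subseteq> {0..<1}"
      unfolding dyadic_rectangles_def dyadic_intervals_def by blast
    have "(2::real) ^ (i + j) = 2 ^ n"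
      using R area_dyadic_rectangle [of m i l j] by simp
    then have n: "i + j = n"
      by (subst (asm) power_inject_exp) auto
    have "m < 2 ^ n" "l < 2 ^ n"
      using bound [OF sub(1)] bound [OF sub(2)] n
        power_increasing [of i n "2::nat"] power_increasing [of j n "2::nat"] by linarith+
    then have "(i, j, m, l) \<in> ?S"
      using n by auto
    then show "R \<in> (\<lambda>(i, j, m, l). ?D m i \<times> ?D l j) ` ?S"
      unfolding R(1) by (rule rev_image_eqI) simp
  qed
  then show ?thesis
    by (rule finite_subset) simp
qed

end

theory Submission
  imports Defs
begin

text \<open>
  The rectangles of area \<open>2 ^ - n\<close> come in \<open>n + 1\<close> shapes \<open>2 ^ - a \<times> 2 ^ - (n - a)\<close>, and those of one
  shape tile the unit square. So the signed Haar sum is a sum of \<open>n + 1\<close> functions with values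
  \<open>\<plusminus> 1\<close>, called layers here, one for each shape (\<open>haar_sum_eq_layers\<close>). The theorem says that on \<open>Q\<close>
  these layers behave like independent fair signs, so that their sum has the law of a simple random
  walk after \<open>n + 1\<close> steps.

  The reason is that the signs of the layers can be revealed one at a time by halving rectangles. At
  a point \<open>(x, y)\<close>, layer \<open>a\<close> is determined by the first \<open>a + 1\<close> binary digits of \<open>x\<close> and the first
  \<open>n - a + 1\<close> digits of \<open>y\<close>, and the last of these digits only enter through a factor \<open>\<plusminus> 1\<close>. Hence
  on a rectangle of size \<open>2 ^ - i \<times> 2 ^ - j\<close> layer \<open>a\<close> is constant if \<open>a < i\<close> and \<open>n - a < j\<close>; call
  it free otherwise. Halving the rectangle in the \<open>x\<close> direction affects at most layer \<open>i\<close>: either it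
  remains free, or it becomes constant on each half, with opposite values on the two halves.
  In the first case the laws on the halves are averaged, in the second the walk makes one more
  step (\<open>walk_law_Un\<close>, \<open>walk_law_insert\<close>). Halving in the \<open>y\<close> direction is symmetric. Starting from
  rectangles so small that no layer is free and going backwards, one obtains the law of the sum of
  the free layers on every rectangle with \<open>i, j \<le> n + 1\<close> (\<open>walk_law_layers\<close>). The condition
  \<open>|Q| \<ge> 2 ^ - (n + 1)\<close> means \<open>i + j \<le> n + 1\<close>, and then all layers are free on \<open>Q\<close>.
\<close>

section \<open>The law of the simple random walk\<close>

text \<open>
  The probability that a simple symmetric random walk is at \<open>v\<close> after \<open>N\<close> steps. The recursion
  over all real \<open>v\<close> matches the halving of rectangles directly, whatever the parity and size of \<open>v\<close>;
  binomial coefficients enter only at the end.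
\<close>

fun walk_prob :: "nat \<Rightarrow> real \<Rightarrow> real" where
  "walk_prob 0 v = of_bool (v = 0)"
| "walk_prob (Suc N) v = (walk_prob N (v - 1) + walk_prob N (v + 1)) / 2"

lemma walk_prob_eq_0: "real N < v \<Longrightarrow> walk_prob N v = 0"
  by (induction N arbitrary: v) auto

text \<open>
  Pascal's rule. The vanishing of \<open>walk_prob\<close> beyond its range is what supplies the boundary
  term at \<open>k = 0\<close>.
\<close>

lemma walk_prob_binomial: "walk_prob N (real N - 2 * real k) = real (N choose k) / 2 ^ N"
proof (induction N arbitrary: k)
  case 0
  then show ?case by (cases k) auto
next
  case (Suc N)
  show ?case
  proof (cases k)
    case 0
    then show ?thesis using Suc.IH [of 0] by (simp add: walk_prob_eq_0 add.commute)
  next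
    case (Suc k')
    have "real (Suc N) - 2 * real k - 1 = real N - 2 * real (Suc k')"
      "real (Suc N) - 2 * real k + 1 = real N - 2 * real k'"
      using Suc by auto
    then have "walk_prob (Suc N) (real (Suc N) - 2 * real k)
        = (real (N choose Suc k') / 2 ^ N + real (N choose k') / 2 ^ N) / 2"
      by (simp only: walk_prob.simps Suc.IH)
    then show ?thesis
      unfolding Suc by (simp add: add_divide_distrib)
  qed
qed

text \<open>
  The value of \<open>F\<close> at a uniformly distributed point of \<open>S\<close> has the law of the random walk. Measurability of
  the level sets is part of the notion, so that it is carried along by the induction on
  rectangles and never has to be derived from a formula for \<open>F\<close>.
\<close>

definition walk_law :: "(real \<times> real \<Rightarrow> real) \<Rightarrow> nat \<Rightarrow> (real \<times> real) set \<Rightarrow> bool" where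
  "walk_law F N S \<longleftrightarrow> S \<in> lmeasurable \<and>
     (\<forall>v. {z \<in> S. F z = v} \<in> lmeasurable \<and> area {z \<in> S. F z = v} = area S * walk_prob N v)"

lemma area_Un_disjoint:
  assumes "A \<in> lmeasurable" "B \<in> lmeasurable" "A \<inter> B = {}"
  shows "area (A \<union> B) = area A + area B"
  using assms measure_Un3 [of A lebesgue B] by simp

lemma walk_law_Un:
  assumes "walk_law F N A" "walk_law F N B" "A \<inter> B = {}"
  shows "walk_law F N (A \<union> B)"
proof -
  have eq: "{z \<in> A \<union> B. F z = v} = {z \<in> A. F z = v} \<union> {z \<in> B. F z = v}" for v by auto
  have disj: "{z \<in> A. F z = v} \<inter> {z \<in> B. F z = v} = {}" for v using assms(3) by auto
  have meas: "{z \<in> A. F z = v} \<in> lmeasurable" "{z \<in> B. F z = v} \<in> lmeasurable" for v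
    using assms(1,2) by (simp_all add: walk_law_def)
  have "area {z \<in> A \<union> B. F z = v} = area (A \<union> B) * walk_prob N v" for v
    unfolding eq area_Un_disjoint [OF meas disj] using assms
    by (simp add: walk_law_def area_Un_disjoint distrib_right)
  moreover have "{z \<in> A \<union> B. F z = v} \<in> lmeasurable" for v
    unfolding eq using meas by (rule fmeasurable.Un)
  ultimately show ?thesis
    using assms by (simp add: walk_law_def fmeasurable.Un)
qed

lemma walk_law_step:
  assumes A: "walk_law F N A" and B: "walk_law F N B" and "A \<inter> B = {}" "area A = area B"
    and t: "t \<in> {-1, 1}"
    and GA: "\<And>z. z \<in> A \<Longrightarrow> G z = F z + t" and GB: "\<And>z. z \<in> B \<Longrightarrow> G z = F z - t"
  shows "walk_law G (Suc N) (A \<union> B)"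
proof -
  have eq: "{z \<in> A \<union> B. G z = v} = {z \<in> A. F z = v - t} \<union> {z \<in> B. F z = v + t}" for v
    by (auto simp: GA GB)
  have disj: "{z \<in> A. F z = v - t} \<inter> {z \<in> B. F z = v + t} = {}" for v using assms(3) by auto
  have meas: "{z \<in> A. F z = v} \<in> lmeasurable" "{z \<in> B. F z = v} \<in> lmeasurable" for v
    using A B by (simp_all add: walk_law_def)
  have sum: "area (A \<union> B) = 2 * area B"
    using A B assms(3,4) by (simp add: walk_law_def area_Un_disjoint)
  have "area {z \<in> A \<union> B. G z = v} = area B * (walk_prob N (v - t) + walk_prob N (v + t))" for v
    unfolding eq area_Un_disjoint [OF meas disj] using A B assms(4)
    by (simp add: walk_law_def distrib_left)
  moreover have "area B * (walk_prob N (v - t) + walk_prob N (v + t)) = area (A \<union> B) * walk_prob (Suc N) v" for v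
    using t by (auto simp: sum add.commute)
  ultimately have "area {z \<in> A \<union> B. G z = v} = area (A \<union> B) * walk_prob (Suc N) v" for v
    by simp
  moreover have "{z \<in> A \<union> B. G z = v} \<in> lmeasurable" for v
    unfolding eq using meas by (rule fmeasurable.Un)
  ultimately show ?thesis
    using A B by (simp add: walk_law_def fmeasurable.Un del: walk_prob.simps)
qed

text \<open>
  The function \<open>g b\<close> is the next step of the walk: it is determined by the half in which the point
  lies, independently of the earlier steps, because they have the same law on both halves.
\<close>

lemma walk_law_insert:
  assumes A: "walk_law (\<lambda>z. \<Sum>a\<in>U. g a z) (card U) A" and B: "walk_law (\<lambda>z. \<Sum>a\<in>U. g a z) (card U) B"
    and "A \<inter> B = {}" "area A = area B" "finite U" "b \<notin> U"
    and t: "t \<in> {-1, 1}"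
    and gA: "\<And>z. z \<in> A \<Longrightarrow> g b z = - t" and gB: "\<And>z. z \<in> B \<Longrightarrow> g b z = t"
  shows "walk_law (\<lambda>z. \<Sum>a\<in>insert b U. g a z) (card (insert b U)) (A \<union> B)"
proof -
  have "- t \<in> {-1, 1}" using t by auto
  with A B assms(3,4) have "walk_law (\<lambda>z. \<Sum>a\<in>insert b U. g a z) (Suc (card U)) (A \<union> B)"
    by (rule walk_law_step) (simp_all add: gA gB assms(5,6))
  then show ?thesis by (simp add: assms(5,6))
qed

section \<open>Dyadic cells and Rademacher functions\<close>

definition cell :: "nat \<Rightarrow> nat \<Rightarrow> real set" where
  "cell i m = {real m / 2 ^ i ..< (real m + 1) / 2 ^ i}"

text \<open>
  The binary digit of \<open>x\<close> of weight \<open>2 ^ - (a + 1)\<close>, written as a sign: it decides in which half of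
  its cell of level \<open>a\<close> the point \<open>x\<close> lies.
\<close>

definition rademacher :: "nat \<Rightarrow> real \<Rightarrow> real" where
  "rademacher a x = (if even \<lfloor>2 ^ Suc a * x\<rfloor> then - 1 else 1)"

text \<open>
  Describing cells by \<open>floor\<close> turns the nesting of dyadic intervals into integer division by
  powers of two.
\<close>

lemma mem_cell_iff: "x \<in> cell i m \<longleftrightarrow> \<lfloor>2 ^ i * x\<rfloor> = int m"
  by (simp add: cell_def floor_eq_iff field_simps)

lemma floor_coarsen:
  fixes x :: real
  assumes "a \<le> i"
  shows "\<lfloor>2 ^ a * x\<rfloor> = \<lfloor>2 ^ i * x\<rfloor> div 2 ^ (i - a)"
proof -
  have "2 ^ a * x = 2 ^ i * x / real_of_int (2 ^ (i - a))"
    using assms by (simp add: power_add [symmetric] field_simps)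
  then show ?thesis
    by (metis floor_divide_real_eq_div zero_le_numeral zero_le_power)
qed

lemma cell_split: "cell i m = cell (Suc i) (2 * m) \<union> cell (Suc i) (2 * m + 1)"
proof -
  have "\<lfloor>2 ^ i * x\<rfloor> = \<lfloor>2 ^ Suc i * x\<rfloor> div 2" for x :: real
    using floor_coarsen [of i "Suc i" x] by simp
  then have "x \<in> cell i m \<longleftrightarrow> x \<in> cell (Suc i) (2 * m) \<or> x \<in> cell (Suc i) (2 * m + 1)" for x
    unfolding mem_cell_iff by presburger
  then show ?thesis by blast
qed

lemma cell_halves_disjoint: "cell (Suc i) (2 * m) \<inter> cell (Suc i) (2 * m + 1) = {}"
  by (auto simp: mem_cell_iff)

lemma rademacher_halves:
  "x \<in> cell (Suc a) (2 * m) \<Longrightarrow> rademacher a x = - 1"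
  "x \<in> cell (Suc a) (2 * m + 1) \<Longrightarrow> rademacher a x = 1"
  by (auto simp: mem_cell_iff rademacher_def)

lemma haar_cell:
  "haar (cell a m) x = (if x \<in> cell a m then rademacher a x else 0)"
proof -
  have "haar (cell a m) x = - indicator (cell (Suc a) (2 * m)) x + indicator (cell (Suc a) (2 * m + 1)) x"
  proof -
    have "real (2 * m) / 2 ^ Suc a = real m / 2 ^ a" "(real (2 * m) + 1) / 2 ^ Suc a = (real m + 1 / 2) / 2 ^ a"
      "real (2 * m + 1) / 2 ^ Suc a = (real m + 1 / 2) / 2 ^ a"
      "(real (2 * m + 1) + 1) / 2 ^ Suc a = (real m + 1) / 2 ^ a"
      by (simp_all add: field_simps)
    then show ?thesis unfolding cell_def haar_dyadic_interval by (simp only:)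
  qed
  then show ?thesis
    using rademacher_halves [of x a m] cell_halves_disjoint [of a m] cell_split [of a m]
    by (auto simp: indicator_def)
qed

lemma cell_Times_lmeasurable: "cell i m \<times> cell j l \<in> lmeasurable"
  unfolding cell_def
  by (intro bounded_set_imp_lmeasurable bounded_Times) (auto simp: borel_Times)

lemma area_cell_Times: "area (cell i m \<times> cell j l) = 1 / 2 ^ (i + j)"
  unfolding cell_def by (rule area_dyadic_rectangle)

lemma cell_in_dyadic_intervals_iff: "cell i m \<in> dyadic_intervals \<longleftrightarrow> m < 2 ^ i"
proof -
  have "cell i m \<subseteq> {0..<1} \<longleftrightarrow> m < 2 ^ i"
  proof
    assume "cell i m \<subseteq> {0..<1}"
    moreover have "real m / 2 ^ i \<in> cell i m" by (simp add: mem_cell_iff)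
    ultimately have "real m < real (2 ^ i)" by (auto simp: field_simps)
    then show "m < 2 ^ i" by (simp only: of_nat_less_iff)
  next
    assume "m < 2 ^ i"
    then have "real (m + 1) \<le> real (2 ^ i)" by (intro of_nat_mono) simp
    then have "(real m + 1) / 2 ^ i \<le> 1" "0 \<le> real m / 2 ^ i" by (simp_all add: field_simps)
    then show "cell i m \<subseteq> {0..<1}" unfolding cell_def
      by (auto simp del: divide_le_eq_1 zero_le_divide_iff)
  qed
  then show ?thesis by (auto simp: dyadic_intervals_def cell_def)
qed

lemma cell_Times_in_dyadic_rectangles:
  "m < 2 ^ i \<Longrightarrow> l < 2 ^ j \<Longrightarrow> cell i m \<times> cell j l \<in> dyadic_rectangles"
  unfolding dyadic_rectangles_def using cell_in_dyadic_intervals_iff by blast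

lemma dyadic_rectangleE:
  assumes "R \<in> dyadic_rectangles"
  obtains i m j l where "R = cell i m \<times> cell j l" "m < 2 ^ i" "l < 2 ^ j"
  using assms cell_in_dyadic_intervals_iff
  unfolding dyadic_rectangles_def dyadic_intervals_def cell_def by blast

lemma cell_Times_inj_level:
  assumes "cell i m \<times> cell j l = cell i' m' \<times> cell j' l'"
  shows "i = i'"
proof -
  have ne: "cell i m \<noteq> {}" for i m
    by (auto simp: cell_def divide_strict_right_mono not_le)
  have "cell i m = cell i' m'" using assms ne by (simp add: times_eq_iff)
  moreover have "Sup (cell i m) - Inf (cell i m) = 1 / 2 ^ i" for i m
    by (simp add: cell_def divide_strict_right_mono diff_divide_distrib [symmetric])
  ultimately have "1 / 2 ^ i = (1 / 2 ^ i' :: real)" by metis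
  then show ?thesis by simp
qed

section \<open>Random-walk law of the layers on a cell\<close>

text \<open>
  The contribution of the shape \<open>2 ^ - a \<times> 2 ^ - (n - a)\<close> to the signed Haar sum: \<open>s a p q\<close> is the sign
  of the rectangle in column \<open>p\<close> and row \<open>q\<close>. The signs are indexed by all integers, so that
  the layers are defined on the whole plane.
\<close>

definition layer :: "nat \<Rightarrow> (nat \<Rightarrow> int \<Rightarrow> int \<Rightarrow> real) \<Rightarrow> nat \<Rightarrow> real \<times> real \<Rightarrow> real" where
  "layer n s a z = s a \<lfloor>2 ^ a * fst z\<rfloor> \<lfloor>2 ^ (n - a) * snd z\<rfloor>
     * rademacher a (fst z) * rademacher (n - a) (snd z)"

text \<open>
  The layers that are not yet constant on rectangles of size \<open>2 ^ - i \<times> 2 ^ - j\<close>.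
\<close>

definition free_layers :: "nat \<Rightarrow> nat \<Rightarrow> nat \<Rightarrow> nat set" where
  "free_layers n i j = {a. a \<le> n \<and> (i \<le> a \<or> j \<le> n - a)}"

lemma finite_free_layers: "finite (free_layers n i j)"
  by (simp add: free_layers_def)

text \<open>
  A cell of level \<open>j\<close> fixes the first \<open>j\<close> binary digits of its points. Level \<open>b\<close> data use the first \<open>b + 1\<close>
  of them, so the inequality has to be strict.
\<close>

lemma coarse_data_const:
  assumes "b < j" "y \<in> cell j l" "y' \<in> cell j l"
  shows "\<lfloor>2 ^ b * y\<rfloor> = \<lfloor>2 ^ b * y'\<rfloor>" "rademacher b y = rademacher b y'"
  using assms floor_coarsen [of b j] floor_coarsen [of "Suc b" j]
  by (simp_all add: mem_cell_iff rademacher_def del: power_Suc)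

text \<open>
  Halving in the \<open>x\<close> direction can only fix layer \<open>i\<close>, halving in the \<open>y\<close> direction only layer
  \<open>n - j\<close>. The induction runs from small rectangles to large ones, and the base case is a rectangle
  on which every layer is constant.
\<close>

lemma walk_law_layers:
  assumes s: "\<And>a p q. s a p q \<in> {-1, 1}" and "i \<le> Suc n" "j \<le> Suc n"
  shows "walk_law (\<lambda>z. \<Sum>a\<in>free_layers n i j. layer n s a z) (card (free_layers n i j))
           (cell i m \<times> cell j l)"
  using assms(2,3)
proof (induction "(Suc n - i) + (Suc n - j)" arbitrary: i j m l rule: less_induct)
  case less
  let ?F = "\<lambda>i j z. \<Sum>a\<in>free_layers n i j. layer n s a z"
  have corner: "real m / 2 ^ i \<in> cell i m" for i m by (simp add: mem_cell_iff)
  consider (x) "i \<le> n" | (y) "j \<le> n" | (base) "i = Suc n" "j = Suc n"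
    using less.prems by linarith
  then show ?case
  proof cases
    case base
    then have "free_layers n i j = {}" by (auto simp: free_layers_def)
    moreover have "{z \<in> cell i m \<times> cell j l. 0 = v} = (if v = 0 then cell i m \<times> cell j l else {})"
      for v :: real by auto
    ultimately show ?thesis
      by (simp add: walk_law_def cell_Times_lmeasurable)
  next
    case x
    let ?A = "cell (Suc i) (2 * m) \<times> cell j l" and ?B = "cell (Suc i) (2 * m + 1) \<times> cell j l"
    have AB: "cell i m \<times> cell j l = ?A \<union> ?B" "?A \<inter> ?B = {}"
      using cell_split [of i m] cell_halves_disjoint [of i m] by auto
    have IH: "walk_law (?F (Suc i) j) (card (free_layers n (Suc i) j)) (cell (Suc i) m' \<times> cell j l)" for m'
      using less.hyps [of "Suc i" j] less.prems x by auto
    show ?thesis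
    proof (cases "n - i < j")
      case False
      then have "free_layers n (Suc i) j = free_layers n i j"
        by (auto simp: free_layers_def Suc_le_eq le_less)
      with IH [of "2 * m"] IH [of "2 * m + 1"] AB show ?thesis
        by (simp add: walk_law_Un)
    next
      case True
      have ins: "free_layers n i j = insert i (free_layers n (Suc i) j)"
        and notin: "i \<notin> free_layers n (Suc i) j"
        using x True by (auto simp: free_layers_def)
      \<comment> \<open>Any point of the side serves here: the \<open>y\<close>-dependent factors of layer \<open>i\<close> are constant on it.\<close>
      define y0 where "y0 = real l / 2 ^ j"
      define t where "t = s i (int m) \<lfloor>2 ^ (n - i) * y0\<rfloor> * rademacher (n - i) y0"
      have t: "t \<in> {-1, 1}"
        using s [of i "int m" "\<lfloor>2 ^ (n - i) * y0\<rfloor>"] by (auto simp: t_def rademacher_def)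
      have const: "layer n s i z = t * rademacher i (fst z)" if "z \<in> ?A \<union> ?B" for z
      proof -
        have "fst z \<in> cell i m" "snd z \<in> cell j l"
          using that unfolding AB(1) [symmetric] by (auto simp: mem_Times_iff)
        moreover have "y0 \<in> cell j l" unfolding y0_def by (rule corner)
        ultimately show ?thesis
          using coarse_data_const [OF True, of "snd z" l y0]
          by (simp add: layer_def t_def mem_cell_iff)
      qed
      show ?thesis
        unfolding AB(1) ins
      proof (rule walk_law_insert [OF IH IH AB(2) _ finite_free_layers notin t])
        show "area ?A = area ?B" by (simp add: area_cell_Times)
      qed (use const rademacher_halves [of _ i m] in \<open>auto simp: mem_Times_iff\<close>)
    qed
  next
    case y
    let ?b = "n - j"
    let ?A = "cell i m \<times> cell (Suc j) (2 * l)" and ?B = "cell i m \<times> cell (Suc j) (2 * l + 1)"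
    have AB: "cell i m \<times> cell j l = ?A \<union> ?B" "?A \<inter> ?B = {}"
      using cell_split [of j l] cell_halves_disjoint [of j l] by auto
    have IH: "walk_law (?F i (Suc j)) (card (free_layers n i (Suc j))) (cell i m \<times> cell (Suc j) l')" for l'
      using less.hyps [of i "Suc j"] less.prems y by auto
    show ?thesis
    proof (cases "?b < i")
      case False
      then have "free_layers n i (Suc j) = free_layers n i j"
        using y by (auto simp: free_layers_def)
      with IH [of "2 * l"] IH [of "2 * l + 1"] AB show ?thesis
        by (simp add: walk_law_Un)
    next
      case True
      have ins: "free_layers n i j = insert ?b (free_layers n i (Suc j))"
        and notin: "?b \<notin> free_layers n i (Suc j)"
        using y True by (auto simp: free_layers_def)
      define x0 where "x0 = real m / 2 ^ i"
      define t where "t = s ?b \<lfloor>2 ^ ?b * x0\<rfloor> (int l) * rademacher ?b x0"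
      have t: "t \<in> {-1, 1}"
        using s [of ?b "\<lfloor>2 ^ ?b * x0\<rfloor>" "int l"] by (auto simp: t_def rademacher_def)
      have const: "layer n s ?b z = t * rademacher j (snd z)" if "z \<in> ?A \<union> ?B" for z
      proof -
        have "fst z \<in> cell i m" "snd z \<in> cell j l"
          using that unfolding AB(1) [symmetric] by (auto simp: mem_Times_iff)
        moreover have "x0 \<in> cell i m" unfolding x0_def by (rule corner)
        ultimately show ?thesis
          using coarse_data_const [OF True, of "fst z" m x0] y
          by (simp add: layer_def t_def mem_cell_iff)
      qed
      show ?thesis
        unfolding AB(1) ins
      proof (rule walk_law_insert [OF IH IH AB(2) _ finite_free_layers notin t])
        show "area ?A = area ?B" by (simp add: area_cell_Times)
      qed (use const rademacher_halves [of _ j l] in \<open>auto simp: mem_Times_iff\<close>)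
    qed
  qed
qed

section \<open>The signed Haar sum\<close>

text \<open>
  Only the rectangles containing the point \<open>z\<close> contribute, and there is exactly one of each shape.
\<close>

lemma haar_sum_eq_layers:
  assumes "z \<in> {0..<1} \<times> {0..<1}"
    and s: "\<And>a p q. p < 2 ^ a \<Longrightarrow> q < 2 ^ (n - a) \<Longrightarrow> a \<le> n \<Longrightarrow>
              s a (int p) (int q) = \<epsilon> (cell a p \<times> cell (n - a) q)"
  shows "(\<Sum>R | R \<in> dyadic_rectangles \<and> area R = 1 / 2 ^ n. \<epsilon> R * haar_rect R z)
           = (\<Sum>a\<le>n. layer n s a z)"
proof -
  obtain x y where z: "z = (x, y)" by (cases z)
  define p where "p a = nat \<lfloor>2 ^ a * x\<rfloor>" for a
  define q where "q a = nat \<lfloor>2 ^ a * y\<rfloor>" for a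
  define P where "P a = cell a (p a) \<times> cell (n - a) (q (n - a))" for a
  have xy: "0 \<le> x" "x < 1" "0 \<le> y" "y < 1" using assms(1) z by auto
  have int: "int (p a) = \<lfloor>2 ^ a * x\<rfloor>" "int (q a) = \<lfloor>2 ^ a * y\<rfloor>" for a
    using xy by (simp_all add: p_def q_def)
  have "p a < 2 ^ a" "q a < 2 ^ a" for a
    using xy by (simp_all add: p_def q_def nat_less_iff floor_less_iff)
  note less = this
  have mem: "x \<in> cell a (p a)" "y \<in> cell a (q a)" for a
    by (simp_all add: mem_cell_iff int)
  let ?S = "{R. R \<in> dyadic_rectangles \<and> area R = 1 / 2 ^ n}"
  have dy: "cell a (p a) \<in> dyadic_intervals" "cell a (q a) \<in> dyadic_intervals" for a
    by (simp_all add: cell_in_dyadic_intervals_iff less)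
  have sub: "P ` {..n} \<subseteq> ?S"
    using dy by (auto simp: P_def dyadic_rectangles_def area_cell_Times)
  have zero: "\<epsilon> R * haar_rect R z = 0" if "R \<in> ?S - P ` {..n}" for R
  proof -
    from that obtain i m j l where R: "R = cell i m \<times> cell j l" "m < 2 ^ i" "l < 2 ^ j"
      by (auto elim: dyadic_rectangleE)
    have "(2::real) ^ (i + j) = 2 ^ n" using that by (simp add: R area_cell_Times)
    then have n: "i + j = n" by (subst (asm) power_inject_exp) auto
    have "x \<notin> cell i m \<or> y \<notin> cell j l"
    proof (rule ccontr)
      assume "\<not> ?thesis"
      then have "m = p i" "l = q j" by (auto simp: mem_cell_iff p_def q_def)
      then have "R = P i" using n by (auto simp: R P_def)
      then show False using that n by auto
    qed
    moreover have "haar_rect R z = haar (cell i m) x * haar (cell j l) y"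
      unfolding R z by (rule haar_rect_Times) (simp_all add: cell_in_dyadic_intervals_iff R)
    ultimately show ?thesis by (auto simp: haar_cell)
  qed
  have "inj_on P {..n}"
    by (auto simp: inj_on_def P_def dest: cell_Times_inj_level)
  have "(\<Sum>R\<in>?S. \<epsilon> R * haar_rect R z) = (\<Sum>R\<in>P ` {..n}. \<epsilon> R * haar_rect R z)"
    using finite_dyadic_rectangles_of_area [of n] sub zero
    by (intro sum.mono_neutral_right) auto
  also have "\<dots> = (\<Sum>a\<le>n. \<epsilon> (P a) * haar_rect (P a) z)"
    using \<open>inj_on P {..n}\<close> by (simp add: sum.reindex)
  also have "\<dots> = (\<Sum>a\<le>n. layer n s a z)"
  proof (rule sum.cong [OF refl])
    fix a assume "a \<in> {..n}"
    then have "s a (int (p a)) (int (q (n - a))) = \<epsilon> (P a)"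
      unfolding P_def using less by (intro s) auto
    then show "\<epsilon> (P a) * haar_rect (P a) z = layer n s a z"
      unfolding P_def z by (simp add: haar_rect_Times dy haar_cell mem layer_def int)
  qed
  finally show ?thesis .
qed

theorem mainTheorem1:
  fixes n k :: nat
    and \<epsilon> :: "(real \<times> real) set \<Rightarrow> real"
    and Q :: "(real \<times> real) set"
  assumes "\<And>R. R \<in> dyadic_rectangles \<Longrightarrow> area R = 1 / 2 ^ n \<Longrightarrow> \<epsilon> R \<in> {-1, 1}"
    and "k \<le> n + 1"
    and "Q \<in> dyadic_rectangles"
    and "area Q \<ge> 1 / 2 ^ (n + 1)"
  shows "area {x \<in> Q. (\<Sum>R | R \<in> dyadic_rectangles \<and> area R = 1 / 2 ^ n. \<epsilon> R * haar_rect R x)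
                         = real n + 1 - 2 * real k}
           = area Q / 2 ^ (n + 1) * real ((n + 1) choose k)"
proof -
  from assms(3) obtain i m j l where Q: "Q = cell i m \<times> cell j l" "m < 2 ^ i" "l < 2 ^ j"
    by (rule dyadic_rectangleE)
  have "(1::real) / 2 ^ (n + 1) \<le> 1 / 2 ^ (i + j)" using assms(4) by (simp only: Q area_cell_Times)
  then have "(2::real) ^ (i + j) \<le> 2 ^ (n + 1)" by (simp add: field_simps del: power_Suc)
  then have ij: "i + j \<le> n + 1" by (subst (asm) power_increasing_iff) auto
  \<comment> \<open>The value \<open>1\<close> is an arbitrary sign for index triples that belong to no rectangle of the sum.\<close>
  define s where "s a p q = (if 0 \<le> p \<and> p < 2 ^ a \<and> 0 \<le> q \<and> q < 2 ^ (n - a) \<and> a \<le> n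
     then \<epsilon> (cell a (nat p) \<times> cell (n - a) (nat q)) else 1)" for a p q
  have s: "s a p q \<in> {-1, 1}" for a p q
  proof (cases "0 \<le> p \<and> p < 2 ^ a \<and> 0 \<le> q \<and> q < 2 ^ (n - a) \<and> a \<le> n")
    case True
    then have "cell a (nat p) \<times> cell (n - a) (nat q) \<in> dyadic_rectangles"
      by (intro cell_Times_in_dyadic_rectangles) (auto simp: nat_less_iff)
    then show ?thesis using True assms(1) by (simp add: s_def area_cell_Times)
  next
    case False
    then show ?thesis by (auto simp: s_def)
  qed
  have free: "free_layers n i j = {..n}"
    using ij by (auto simp: free_layers_def)
  have unit: "Q \<subseteq> {0..<1} \<times> {0..<1}"
    using assms(3) by (auto simp: dyadic_rectangles_def dyadic_intervals_def)
  have "(\<Sum>R | R \<in> dyadic_rectangles \<and> area R = 1 / 2 ^ n. \<epsilon> R * haar_rect R z)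
          = (\<Sum>a\<le>n. layer n s a z)" if "z \<in> Q" for z
    using that unit by (intro haar_sum_eq_layers) (auto simp: s_def nat_less_iff)
  then have "{z \<in> Q. (\<Sum>R | R \<in> dyadic_rectangles \<and> area R = 1 / 2 ^ n. \<epsilon> R * haar_rect R z)
                       = real n + 1 - 2 * real k}
     = {z \<in> Q. (\<Sum>a\<le>n. layer n s a z) = real (n + 1) - 2 * real k}"
    by (auto simp: add.commute)
  moreover have "walk_law (\<lambda>z. \<Sum>a\<le>n. layer n s a z) (n + 1) Q"
    using walk_law_layers [OF s, where i = i and j = j and n = n and m = m and l = l] ij by (simp add: free Q)
  ultimately show ?thesis
    by (simp add: walk_law_def walk_prob_binomial del: of_nat_add of_nat_Suc walk_prob.simps power_Suc)
qed

end
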